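(* For every even positive integer $n$, $$C_{\mathbb{R},n}=2^{\frac{n+2}{8}}\, r_{n}.$$
   Context: For $p>0$ put $A_p=\sqrt{2}\left(\frac{\Gamma((p+1)/2)}{\sqrt{\pi}}\right)^{1/p}$, where $\Gamma$ is the Gamma function. The real numbers $C_{\mathbb{R},n}$, $n\ge 2$ (estimates for the constants in the real Bohnenblust--Hille inequality), are defined recursively by $C_{\mathbb{R},2}=2^{1/2}$, $C_{\mathbb{R},3}=2^{5/6}$, and $$C_{\mathbb{R},n}=2^{\frac12}\left(\frac{C_{\mathbb{R},n-2}}{A_{\frac{2n-4}{n-1}}^{2}}\right)^{\frac{n-2}{n}}\quad\text{for } n>3.$$ For even positive integers $n$ define $$r_n=\frac{1}{2^{\frac{n-2}{4}}\left[\prod_{k=1}^{\frac{n-2}{2}}\left(\frac{\Gamma\left(\frac{6k+1}{4k+2}\right)}{\sqrt{\pi}}\right)^{2k+1}\right]^{1/n}}$$ (an empty product equals $1$). *)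

theory Defs
  imports "HOL-Analysis.Analysis"
begin

definition A_const :: "real \<Rightarrow> real" where
  "A_const p = sqrt 2 * (Gamma ((p + 1) / 2) / sqrt pi) powr (1 / p)"

(* Only the values at n \<ge> 2 are meaningful. *)
fun C_real :: "nat \<Rightarrow> real" where
  "C_real n =
    (if n = 2 then 2 powr (1 / 2)
     else if n = 3 then 2 powr (5 / 6)
     else if n > 3 then
       2 powr (1 / 2) *
         (C_real (n - 2) / (A_const ((2 * real n - 4) / (real n - 1)))\<^sup>2)
           powr ((real n - 2) / real n)
     else undefined)"

(* The recursion equation has no constructor patterns, so as a rewrite rule it would loop. *)
declare C_real.simps [simp del]

(* Only the values at even n \<ge> 2 are meaningful; for these "div" is exact division. *)
definition r_const :: "nat \<Rightarrow> real" where
  "r_const n =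
    1 / (2 powr ((real n - 2) / 4) *
         (\<Prod>k = 1..(n - 2) div 2.
            (Gamma ((6 * real k + 1) / (4 * real k + 2)) / sqrt pi) ^ (2 * k + 1))
           powr (1 / real n))"

end

theory Submission imports Defs begin

text \<open>
  Write \<open>n = 2 m + 2\<close>. In the step from \<open>m\<close> to \<open>m + 1\<close> the argument of \<open>A\<close> is \<open>4 k / (2 k + 1)\<close>
  with \<open>k = m + 1\<close>, so \<open>A\<^sup>2\<close> is twice a power of the \<open>k\<close>-th Gamma ratio. Unrolling the recursion
  then amounts to adding up exponents: each Gamma ratio \<open>g\<close> enters as
  \<open>g powr (- (2 k + 1) / n)\<close>, and the power of 2 has exponent \<open>(2 - m) / 4\<close>.
\<close>

definition gamma_ratio :: "nat \<Rightarrow> real" where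
  "gamma_ratio k = Gamma ((6 * real k + 1) / (4 * real k + 2)) / sqrt pi"

lemma gamma_ratio_pos: "gamma_ratio k > 0"
  unfolding gamma_ratio_def by (intro divide_pos_pos Gamma_real_pos) auto

lemma prod_gamma_ratio_pos: "(\<Prod>k = 1..m. gamma_ratio k ^ (2 * k + 1)) > 0"
  by (intro prod_pos) (simp add: gamma_ratio_pos)

text \<open>For \<open>p = 4 * k / (2 * k + 1)\<close>, the value \<open>(p + 1) / 2\<close> is
  exactly the Gamma argument in \<open>r_const\<close>, and squaring doubles the exponent
  \<open>1 / p = (2 * k + 1) / (4 * k)\<close>.\<close>

lemma A_const_sq:
  assumes "k > 0"
  shows "(A_const (4 * real k / (2 * real k + 1)))\<^sup>2
    = 2 * gamma_ratio k powr ((2 * real k + 1) / (2 * real k))"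
proof -
  have arg: "(4 * real k / (2 * real k + 1) + 1) / 2 = (6 * real k + 1) / (4 * real k + 2)"
    by (simp add: divide_simps)
  have "A_const (4 * real k / (2 * real k + 1))
    = sqrt 2 * gamma_ratio k powr ((2 * real k + 1) / (4 * real k))"
    unfolding A_const_def arg gamma_ratio_def by simp
  moreover have "(2 * real k + 1) / (4 * real k) + (2 * real k + 1) / (4 * real k)
    = (2 * real k + 1) / (2 * real k)"
    using assms by (simp add: field_simps)
  ultimately show ?thesis
    by (simp add: power_mult_distrib power2_eq_square[of "_ powr _"] flip: powr_add)
qed

text \<open>Bookkeeping for one unrolling: positivity lets \<open>powr\<close> distribute, and the 2
  in the denominator, coming from the square of \<open>A_const\<close>, accounts for
  \<open>- e\<close>.\<close>

lemma powr_step: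
  fixes P g :: real
  assumes "P > 0" "g > 0"
  shows "2 powr h * (2 powr a * P powr b / (2 * g powr c)) powr e
    = 2 powr (h + a * e - e) * P powr (b * e) * g powr (- (c * e))"
  using assms
  by (simp add: powr_mult powr_divide powr_powr powr_diff powr_add powr_minus_divide)

lemma C_real_even:
  "C_real (2 * m + 2) =
    2 powr ((2 - real m) / 4) *
      (\<Prod>k = 1..m. gamma_ratio k ^ (2 * k + 1)) powr (- 1 / (2 * real m + 2))"
proof (induction m)
  case 0
  show ?case by (simp add: C_real.simps)
next
  case (Suc m)
  define P where "P = (\<Prod>k = 1..m. gamma_ratio k ^ (2 * k + 1))"
  define g where "g = gamma_ratio (Suc m)"
  \<comment> \<open>\<open>x\<close> is half the previous index \<open>2 * m + 2\<close> and also
    the index \<open>k = Suc m\<close> of the new ratio; the outer exponent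
    \<open>(n - 2) / n\<close> becomes \<open>x / (x + 1)\<close>.\<close>
  define x where "x = real m + 1"
  define e where "e = x / (x + 1)"
  have x: "x > 0" and mx: "real m = x - 1" by (simp_all add: x_def)
  have P: "P > 0" unfolding P_def by (rule prod_gamma_ratio_pos)
  have g: "g > 0" unfolding g_def by (rule gamma_ratio_pos)
  have arg: "(2 * real (2 * Suc m + 2) - 4) / (real (2 * Suc m + 2) - 1)
    = 4 * real (Suc m) / (2 * real (Suc m) + 1)"
    by (simp add: field_simps)
  have ex: "(real (2 * Suc m + 2) - 2) / real (2 * Suc m + 2) = e"
    by (simp add: e_def x_def divide_simps) (simp add: algebra_simps)
  \<comment> \<open>The index is even and at least 4, so the recursive branch applies.\<close>
  have "C_real (2 * Suc m + 2) = 2 powr (1 / 2) *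
      (C_real (2 * m + 2) / (2 * g powr ((2 * x + 1) / (2 * x)))) powr e"
    using A_const_sq[of "Suc m"] unfolding C_real.simps[of "2 * Suc m + 2"] arg ex
    by (simp add: g_def x_def add.commute)
  also have "C_real (2 * m + 2) = 2 powr ((3 - x) / 4) * P powr (- 1 / (2 * x))"
    unfolding Suc.IH by (simp add: P_def x_def)
  also have "2 powr (1 / 2) * (2 powr ((3 - x) / 4) * P powr (- 1 / (2 * x)) /
      (2 * g powr ((2 * x + 1) / (2 * x)))) powr e
    = 2 powr (1 / 2 + (3 - x) / 4 * e - e) * P powr (- 1 / (2 * x) * e)
      * g powr (- ((2 * x + 1) / (2 * x) * e))"
    using P g by (intro powr_step)
  also have "1 / 2 + (3 - x) / 4 * e - e = (2 - x) / 4"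
    using x unfolding e_def by (simp add: divide_simps) (simp add: algebra_simps)
  \<comment> \<open>Raising to \<open>e = (n - 2) / n\<close> turns the root of order
    \<open>n - 2\<close> into one of order \<open>n\<close>.\<close>
  also have "- 1 / (2 * x) * e = - 1 / (2 * x + 2)"
    using x unfolding e_def by (simp add: divide_simps)
  \<comment> \<open>Splitting off the exponent already carried by \<open>P\<close> lets
    \<open>g ^ (2 * Suc m + 1)\<close> join the product as its next factor.\<close>
  also have "- ((2 * x + 1) / (2 * x) * e) = (2 * x + 1) * (- 1 / (2 * x + 2))"
    using x unfolding e_def by (simp add: divide_simps)
  also have "g powr ((2 * x + 1) * (- 1 / (2 * x + 2)))
    = (g ^ (2 * Suc m + 1)) powr (- 1 / (2 * x + 2))"
  proof -
    have "g ^ (2 * Suc m + 1) = g powr (2 * x + 1)"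
      using powr_realpow[OF g, of "2 * Suc m + 1"] by (simp add: x_def add.commute distrib_left)
    then show ?thesis by (simp add: powr_powr)
  qed
  also have "2 powr ((2 - x) / 4) * P powr (- 1 / (2 * x + 2))
      * (g ^ (2 * Suc m + 1)) powr (- 1 / (2 * x + 2))
    = 2 powr ((2 - x) / 4) * (P * g ^ (2 * Suc m + 1)) powr (- 1 / (2 * x + 2))"
    using P g by (simp add: powr_mult)
  also have "P * g ^ (2 * Suc m + 1) = (\<Prod>k = 1..Suc m. gamma_ratio k ^ (2 * k + 1))"
    by (simp add: P_def g_def mult.commute)
  finally show ?case by (simp add: x_def add.commute)
qed

theorem theorem2p3:
  fixes n :: nat
  assumes "n > 0" and "even n"
  shows "C_real n = 2 powr ((real n + 2) / 8) * r_const n"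
proof -
  obtain j where "n = 2 * j" using \<open>even n\<close> by (elim evenE)
  with \<open>n > 0\<close> obtain m where n: "n = 2 * m + 2" by (cases j) auto
  define P where "P = (\<Prod>k = 1..m. gamma_ratio k ^ (2 * k + 1))"
  have r: "r_const n = 1 / (2 powr (real m / 2) * P powr (1 / (2 * real m + 2)))"
    by (simp add: r_const_def P_def gamma_ratio_def n add.commute)
  \<comment> \<open>The part \<open>real m / 2\<close> is the power of 2 in the denominator of
    \<open>r_const n\<close>.\<close>
  have e: "(2 - real m) / 4 = (real n + 2) / 8 - real m / 2"
    by (simp add: n field_simps)
  show ?thesis
    using C_real_even[of m] unfolding r n[symmetric] e P_def[symmetric]
    by (simp add: powr_diff powr_minus_divide)
qed

end
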